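(* Let $M\subset l^{\infty}$ be a predual of $l_1$ such that: (a) $e\in M$; (b) $M_+$ is weakly*-dense in $l^{\infty}_+$; (c) if $x\in M_+$, then $x^{\frac12}\in M_+$. Then there is a compact Hausdorff topology $\mathcal{T}$ on the set of natural numbers $\mathbb{N}$ such that $M=C_{\tau}(\mathbb{N})$, i.e. $M$ is exactly the set of those $x\in l^\infty$ which, regarded as functions $\mathbb{N}\to\mathbb{C}$, are continuous with respect to $\mathcal{T}$.
   Context: $\mathbb{N}=\{1,2,3,\dots\}$. $l_1$ is the complex Banach space of absolutely summable complex sequences with norm $\|a\|_1=\sum_i|a_i|$, and $l^\infty$ is the complex Banach space of bounded complex sequences with the supremum norm, identified with $l_1^*$ through the pairing $\langle x,y\rangle=\sum_{i}x_iy_i$ ($x\in l^\infty$, $y\in l_1$); the weak* topology on $l^\infty$ is the one induced by this duality. A predual of $l_1$ contained in $l^\infty$ means a norm-closed linear subspace $M\subset l^\infty$ for which the canonical map $l_1\to M^*$, sending $y\in l_1$ to the functional $x\mapsto\sum_i x_iy_i$ on $M$, is an isometric isomorphism of $l_1$ onto $M^*$. The sequence constantly equal to $1$ is denoted by $e\in l^\infty$. An element $x\in l^\infty$ is positive if $x_i\ge 0$ for every $i\in\mathbb{N}$; $l^\infty_+$ is the set of positive elements of $l^\infty$, and $M_+=M\cap l^\infty_+$. For $x\in l^\infty_+$, $x^{\frac12}$ is the positive sequence with entries $x^{\frac12}(i)=x_i^{\frac12}$. For a compact Hausdorff topology $\mathcal{T}$ on $\mathbb{N}$, $C_{\tau}(\mathbb{N})$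 is the space of $\mathcal{T}$-continuous functions $\mathbb{N}\to\mathbb{C}$, viewed as a subspace of $l^\infty$. *)

theory Defs
  imports "HOL-Analysis.Analysis"
begin

text \<open>
  As \<^typ>\<open>nat\<close> carries the discrete topology, \<open>nat \<Rightarrow>\<^sub>C complex\<close> consists of all bounded complex
  sequences, with the supremum norm. Sequences are indexed from \<open>0\<close> instead of \<open>1\<close>.
\<close>

type_synonym linf = "nat \<Rightarrow>\<^sub>C complex"

text \<open>The library makes \<^typ>\<open>linf\<close> a real normed space only, hence the explicit complex scaling.\<close>

definition cscale :: "complex \<Rightarrow> linf \<Rightarrow> linf" where
  "cscale c x = Bcontfun (\<lambda>i. c * x i)"

lemma apply_cscale [simp]: "cscale c x i = c * x i"
proof -
  obtain B where "\<And>i. norm (x i) \<le> B"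
    using bounded_apply_bcontfun[of x] by (auto simp: bounded_iff)
  then have "norm (c * x i) \<le> norm c * B" for i
    by (simp add: norm_mult mult_left_mono)
  then have "(\<lambda>i. c * x i) \<in> bcontfun"
    by (auto simp: bcontfun_def bounded_iff)
  then show ?thesis
    by (simp add: cscale_def Bcontfun_inverse)
qed

definition csubspace :: "linf set \<Rightarrow> bool" where
  "csubspace M \<longleftrightarrow>
     0 \<in> M \<and> (\<forall>x\<in>M. \<forall>y\<in>M. x + y \<in> M) \<and> (\<forall>c. \<forall>x\<in>M. cscale c x \<in> M)"

definition l1 :: "(nat \<Rightarrow> complex) set" where
  "l1 = {y. summable (\<lambda>i. norm (y i))}"

definition l1_norm :: "(nat \<Rightarrow> complex) \<Rightarrow> real" where
  "l1_norm y = (\<Sum>i. norm (y i))"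

definition pairing :: "linf \<Rightarrow> (nat \<Rightarrow> complex) \<Rightarrow> complex" where
  "pairing x y = (\<Sum>i. x i * y i)"

text \<open>Functionals on \<open>M\<close> are taken in \<^term>\<open>extensional M\<close>, so that equality means equality on \<open>M\<close>.\<close>

definition dual_space :: "linf set \<Rightarrow> (linf \<Rightarrow> complex) set" where
  "dual_space M = {f \<in> extensional M.
     (\<forall>x\<in>M. \<forall>y\<in>M. f (x + y) = f x + f y) \<and>
     (\<forall>c. \<forall>x\<in>M. f (cscale c x) = c * f x) \<and>
     (\<exists>K. \<forall>x\<in>M. norm (f x) \<le> K * norm x)}"

definition dual_norm :: "linf set \<Rightarrow> (linf \<Rightarrow> complex) \<Rightarrow> real" where
  "dual_norm M f = (SUP x\<in>{x \<in> M. norm x \<le> 1}. norm (f x))"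

definition canonical_map :: "linf set \<Rightarrow> (nat \<Rightarrow> complex) \<Rightarrow> (linf \<Rightarrow> complex)" where
  "canonical_map M y = (\<lambda>x\<in>M. pairing x y)"

lemma canonical_map_linear:
  assumes "y \<in> l1" "z \<in> l1" "x \<in> M"
  shows "canonical_map M (\<lambda>i. a * y i + b * z i) x =
           a * canonical_map M y x + b * canonical_map M z x"
proof -
  have *: "summable (\<lambda>i. x i * w i)" if "w \<in> l1" for w
  proof (rule summable_comparison_test')
    show "summable (\<lambda>i. norm x * norm (w i))"
      using that by (auto simp: l1_def intro: summable_mult)
    show "norm (x i * w i) \<le> norm x * norm (w i)" for i
      by (simp add: norm_mult mult_right_mono norm_bounded)
  qed
  have "(\<Sum>i. x i * (a * y i + b * z i)) = (\<Sum>i. a * (x i * y i) + b * (x i * z i))"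
    by (simp add: algebra_simps)
  also have "\<dots> = a * (\<Sum>i. x i * y i) + b * (\<Sum>i. x i * z i)"
    using *[OF assms(1)] *[OF assms(2)]
    by (simp add: suminf_add[symmetric] suminf_mult summable_mult)
  finally show ?thesis
    using assms(3) by (simp add: canonical_map_def pairing_def)
qed

text \<open>Isometric isomorphism onto the dual; linearity is \<open>canonical_map_linear\<close>.\<close>

definition l1_predual :: "linf set \<Rightarrow> bool" where
  "l1_predual M \<longleftrightarrow>
     csubspace M \<and> closed M \<and>
     bij_betw (canonical_map M) l1 (dual_space M) \<and>
     (\<forall>y\<in>l1. dual_norm M (canonical_map M y) = l1_norm y)"

text \<open>The coarsest topology making \<open>\<lambda>x. pairing x y\<close> continuous for every \<open>y \<in> l1\<close>.\<close>

definition weak_star_topology :: "linf topology" where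
  "weak_star_topology =
     pullback_topology UNIV (\<lambda>x. \<lambda>y\<in>l1. pairing x y) (product_topology (\<lambda>_. euclidean) l1)"

definition linf_pos :: "linf set" where
  "linf_pos = {x :: linf. \<forall>i. x i \<in> \<real>\<^sub>\<ge>\<^sub>0}"

text \<open>On nonnegative reals \<^const>\<open>csqrt\<close> is the nonnegative square root.\<close>

definition linf_sqrt :: "linf \<Rightarrow> linf" where
  "linf_sqrt x = Bcontfun (\<lambda>i. csqrt (x i))"

lemma apply_linf_sqrt [simp]: "linf_sqrt x i = csqrt (x i)"
proof -
  obtain B where "\<And>i. norm (x i) \<le> B"
    using bounded_apply_bcontfun[of x] by (auto simp: bounded_iff)
  then have "norm (csqrt (x i)) \<le> sqrt B" for i
    by simp
  then have "(\<lambda>i. csqrt (x i)) \<in> bcontfun"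
    by (auto simp: bcontfun_def bounded_iff simp del: norm_csqrt)
  then show ?thesis
    by (simp add: linf_sqrt_def Bcontfun_inverse)
qed

text \<open>For compact \<open>T\<close> every continuous function is bounded, so no function is lost in \<^typ>\<open>linf\<close>.\<close>

definition C_tau :: "nat topology \<Rightarrow> linf set" where
  "C_tau T = {x. continuous_map T euclidean (apply_bcontfun x)}"

end

theory Submission
  imports Defs
begin

text \<open>
  Evaluation at the points of \<open>\<nat>\<close> embeds \<open>\<nat>\<close> into \<open>\<complex>\<^sup>M\<close>; the topology sought is the one induced by
  this embedding, i.e. the coarsest one that makes all members of \<open>M\<close> continuous.

  The square root enters through \<open>\<surd>(1 + s) = 1 + s/2 - s\<^sup>2/8 + O(s\<^sup>3)\<close>: for a real \<open>x \<in> M\<close>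
  and \<open>s = t x\<close> with \<open>t \<rightarrow> 0\<close>, the elements \<open>8 (1 + t x/2 - \<surd>(1 + t x)) / t\<^sup>2\<close> of \<open>M\<close> converge uniformly
  to \<open>x\<^sup>2\<close>, so \<open>x\<^sup>2 \<in> M\<close> because \<open>M\<close> is closed (\<open>real_members_square\<close>). By polarization the real
  members of \<open>M\<close> form an algebra \<open>R\<close>.

  The image of \<open>\<nat>\<close> is compact because it is closed in a product of discs
  (\<open>compact_range_evaluation\<close>). A limit \<open>p\<close> of evaluations is a bounded functional
  on \<open>M\<close>, hence given by some \<open>y \<in> l\<^sub>1\<close>, and it is multiplicative on \<open>R\<close>. So for \<open>g \<in> R\<close> the sequence
  \<open>(g - p(g)) y\<close> annihilates \<open>M\<^sub>+\<close> and, by weak* density, vanishes: every \<open>g \<in> R\<close> is constant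
  on the support of \<open>y\<close>. As \<open>R\<close> separates points and \<open>p(e) = 1\<close>, that support is a single
  point \<open>j\<close> and \<open>y\<^sub>j = 1\<close>, i.e. \<open>p\<close> is evaluation at \<open>j\<close>.

  Finally \<open>R\<close> is a uniformly closed algebra that contains the constants and separates the points of
  a compact Hausdorff space, hence contains all continuous real functions by the Stone--Weierstrass
  theorem, and \<open>R + \<i> R \<subseteq> M \<subseteq> C\<^sub>\<tau>(\<nat>) \<subseteq> R + \<i> R\<close>. Closedness of \<open>M\<close>
  under complex conjugation comes out of this chain.
\<close>

section \<open>Sequences that annihilate a weak* dense set\<close>

lemma mult_linf_in_l1:
  fixes x :: linf
  assumes "y \<in> l1"
  shows "(\<lambda>i. x i * y i) \<in> l1"
  unfolding l1_def mem_Collect_eq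
proof (rule summable_comparison_test')
  show "summable (\<lambda>i. norm x * norm (y i))"
    using assms by (auto simp: l1_def intro: summable_mult)
  show "norm (norm (x i * y i)) \<le> norm x * norm (y i)" for i
    by (simp add: norm_mult mult_right_mono norm_bounded)
qed

lemma summable_pairing:
  fixes x :: linf
  assumes "y \<in> l1"
  shows "summable (\<lambda>i. x i * y i)"
  using mult_linf_in_l1[OF assms] by (auto simp: l1_def intro: summable_norm_cancel)

lemma continuous_map_pairing:
  assumes "y \<in> l1"
  shows "continuous_map weak_star_topology euclidean (\<lambda>x. pairing x y)"
proof -
  have "continuous_map weak_star_topology euclidean ((\<lambda>f. f y) \<circ> (\<lambda>x. \<lambda>y\<in>l1. pairing x y))"
    unfolding weak_star_topology_def
    by (intro continuous_map_pullback continuous_map_product_projection assms)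
  then show ?thesis
    using assms by (simp add: o_def)
qed

lemma topspace_weak_star [simp]: "topspace weak_star_topology = UNIV"
  by (auto simp: weak_star_topology_def topspace_pullback_topology)

definition unit_vector :: "nat \<Rightarrow> linf" where
  "unit_vector j = Bcontfun (\<lambda>i. if i = j then 1 else 0)"

lemma apply_unit_vector [simp]: "unit_vector j i = (if i = j then 1 else 0)"
proof -
  have "(\<lambda>i. if i = j then 1 else (0::complex)) \<in> bcontfun"
    by (auto simp: bcontfun_def bounded_iff intro!: exI[of _ 1])
  then show ?thesis
    by (simp add: unit_vector_def Bcontfun_inverse)
qed

lemma pairing_unit_vector [simp]: "pairing (unit_vector j) y = y j"
proof -
  have "pairing (unit_vector j) y = (\<Sum>i. if i = j then y i else 0)"
    unfolding pairing_def by (rule suminf_cong) simp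
  also have "\<dots> = y j"
    using sums_single[of j y] by (simp add: sums_iff)
  finally show ?thesis .
qed

text \<open>The elements of \<open>l\<^sup>\<infinity>\<close> that pair to \<open>0\<close> with \<open>y\<close> form a weak* closed set. It contains the
  positive cone as soon as it contains \<open>A\<close>, and the unit vectors are positive.\<close>

lemma weak_star_dense_annihilator:
  assumes dense: "linf_pos \<subseteq> weak_star_topology closure_of A"
    and y: "y \<in> l1" and zero: "\<And>x. x \<in> A \<Longrightarrow> pairing x y = 0"
  shows "y i = 0"
proof -
  have "closedin weak_star_topology {x \<in> topspace weak_star_topology. pairing x y \<in> {0}}"
    by (rule closedin_continuous_map_preimage[OF continuous_map_pairing[OF y]]) simp
  then have "weak_star_topology closure_of A \<subseteq> {x. pairing x y \<in> {0}}"
    using zero by (intro closure_of_minimal) auto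
  moreover have "unit_vector i \<in> linf_pos"
    by (simp add: linf_pos_def)
  ultimately have "pairing (unit_vector i) y = 0"
    using dense by blast
  then show ?thesis
    by simp
qed

text \<open>Two points of \<open>\<nat>\<close> at which all members of \<open>A\<close> agree would make the difference of the
  two unit vectors annihilate \<open>A\<close>.\<close>

lemma weak_star_dense_separates:
  assumes dense: "linf_pos \<subseteq> weak_star_topology closure_of A" and "i \<noteq> j"
  obtains x where "x \<in> A" "x i \<noteq> x j"
proof -
  have l1: "apply_bcontfun (unit_vector k) \<in> l1" for k
  proof -
    have "summable (\<lambda>i. if i = k then 1 else (0::real))"
      using sums_single[of k "\<lambda>_. 1::real"] by (auto simp: summable_def)
    then show ?thesis
      by (simp add: l1_def if_distrib cong: if_cong)
  qed
  \<comment> \<open>The coefficients are written in the form that \<open>canonical_map_linear\<close> expects.\<close>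
  define y where "y = (\<lambda>k. 1 * unit_vector i k + (- 1) * unit_vector j k)"
  have pair_unit: "pairing x (unit_vector k) = x k" for x k
  proof -
    have "pairing x (unit_vector k) = pairing (unit_vector k) x"
      by (simp add: pairing_def mult.commute)
    then show ?thesis by simp
  qed
  have y: "y \<in> l1"
    unfolding l1_def mem_Collect_eq
  proof (rule summable_comparison_test')
    show "summable (\<lambda>k. norm (unit_vector i k) + norm (unit_vector j k))"
      using l1 by (intro summable_add) (auto simp: l1_def)
    show "norm (norm (y k)) \<le> norm (unit_vector i k) + norm (unit_vector j k)" for k
      by (auto simp: y_def)
  qed
  have pair: "pairing x y = x i - x j" if "x \<in> A" for x
    using canonical_map_linear[OF l1 l1 that, of 1 i "- 1" j] that
    by (simp add: canonical_map_def y_def pair_unit)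
  have "y i \<noteq> 0"
    using \<open>i \<noteq> j\<close> by (simp add: y_def)
  then obtain x where "x \<in> A" "pairing x y \<noteq> 0"
    using weak_star_dense_annihilator[OF dense y] by metis
  then show ?thesis
    using pair that by auto
qed

section \<open>The real members of a space closed under square roots\<close>

definition real_members :: "linf set \<Rightarrow> (nat \<Rightarrow> real) set" where
  "real_members M = {g. \<exists>x\<in>M. \<forall>i. x i = complex_of_real (g i)}"

lemma real_membersE:
  assumes "g \<in> real_members M"
  obtains x where "x \<in> M" "\<And>i. x i = complex_of_real (g i)"
  using assms by (auto simp: real_members_def)

text \<open>Substituting \<open>s = u\<^sup>2 - 1\<close> with \<open>u = \<surd>(1 + s)\<close> turns the left-hand side into
  \<open>\<bar>u - 1\<bar>\<^sup>3 (u + 3) = \<bar>s\<bar>\<^sup>3 (u + 3) / (u + 1)\<^sup>3\<close>, and the last quotient is at most its value \<open>3\<close>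
  at \<open>u = 0\<close>.\<close>

lemma sqrt_second_order_error:
  fixes s :: real
  assumes "- 1 \<le> s"
  shows "\<bar>8 * (1 + s / 2 - sqrt (1 + s)) - s\<^sup>2\<bar> \<le> 3 * \<bar>s\<bar> ^ 3"
proof -
  define u where "u = sqrt (1 + s)"
  have u: "0 \<le> u" "s = u\<^sup>2 - 1"
    using assms by (auto simp: u_def)
  have s: "s = (u - 1) * (u + 1)"
    by (simp add: u power2_eq_square algebra_simps)
  have "8 * (1 + s / 2 - u) - s\<^sup>2 = - ((u - 1) ^ 3 * (u + 3))"
    unfolding u(2) by (simp add: power2_eq_square power3_eq_cube field_simps)
  then have "\<bar>8 * (1 + s / 2 - u) - s\<^sup>2\<bar> = \<bar>u - 1\<bar> ^ 3 * (u + 3)"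
    using u(1) by (simp add: abs_mult power_abs)
  also have "\<dots> \<le> \<bar>u - 1\<bar> ^ 3 * (3 * (u + 1) ^ 3)"
  proof (rule mult_left_mono)
    have "3 * (u + 1) ^ 3 - (u + 3) = 3 * u ^ 3 + 9 * u\<^sup>2 + 8 * u"
      by (simp add: power2_eq_square power3_eq_cube algebra_simps)
    moreover have "0 \<le> 3 * u ^ 3 + 9 * u\<^sup>2 + 8 * u"
      using u(1) by (intro add_nonneg_nonneg mult_nonneg_nonneg) auto
    ultimately show "u + 3 \<le> 3 * (u + 1) ^ 3"
      by linarith
  qed simp
  also have "\<dots> = 3 * \<bar>s\<bar> ^ 3"
    using u(1) by (simp add: s abs_mult power_mult_distrib)
  finally show ?thesis
    by (simp add: u_def)
qed

locale sqrt_closed_space =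
  fixes M :: "linf set"
  assumes subspace: "csubspace M" and closed: "closed M"
    and unit: "const_bcontfun 1 \<in> M"
    and sqrt: "\<And>x. x \<in> M \<inter> linf_pos \<Longrightarrow> linf_sqrt x \<in> M \<inter> linf_pos"
begin

lemma add_mem: "x \<in> M \<Longrightarrow> y \<in> M \<Longrightarrow> x + y \<in> M"
  and cscale_mem: "x \<in> M \<Longrightarrow> cscale c x \<in> M"
  using subspace by (auto simp: csubspace_def)

lemma real_members_const: "(\<lambda>_. c) \<in> real_members M"
  unfolding real_members_def
  by (auto intro!: bexI[OF _ cscale_mem[OF unit, of "of_real c"]] simp: const_bcontfun.rep_eq)

lemma real_members_add:
  assumes "g \<in> real_members M" "h \<in> real_members M"
  shows "(\<lambda>i. g i + h i) \<in> real_members M"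
proof -
  obtain x y where "x \<in> M" "\<And>i. x i = of_real (g i)" "y \<in> M" "\<And>i. y i = of_real (h i)"
    using assms by (metis real_membersE)
  then show ?thesis
    unfolding real_members_def by (auto intro!: bexI[OF _ add_mem[of x y]])
qed

lemma real_members_scale:
  assumes "g \<in> real_members M"
  shows "(\<lambda>i. c * g i) \<in> real_members M"
proof -
  obtain x where "x \<in> M" "\<And>i. x i = of_real (g i)"
    using assms by (metis real_membersE)
  then show ?thesis
    unfolding real_members_def by (auto intro!: bexI[OF _ cscale_mem[of x "of_real c"]])
qed

lemma real_members_diff:
  assumes "g \<in> real_members M" "h \<in> real_members M"
  shows "(\<lambda>i. g i - h i) \<in> real_members M"
  using real_members_add[OF assms(1) real_members_scale[OF assms(2), of "- 1"]] by simp

lemma real_members_sqrt: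
  assumes "g \<in> real_members M" and "\<And>i. 0 \<le> g i"
  shows "(\<lambda>i. sqrt (g i)) \<in> real_members M"
proof -
  obtain x where x: "x \<in> M" "\<And>i. x i = of_real (g i)"
    using assms by (metis real_membersE)
  then have "linf_sqrt x \<in> M"
    using sqrt[of x] assms(2) by (simp add: linf_pos_def)
  then show ?thesis
    unfolding real_members_def using x assms(2)
    by (auto intro!: bexI[of _ "linf_sqrt x"])
qed

lemma real_members_bounded:
  assumes "g \<in> real_members M"
  obtains B where "0 < B" "\<And>i. \<bar>g i\<bar> \<le> B"
proof -
  obtain x where x: "x \<in> M" "\<And>i. x i = of_real (g i)"
    using assms by (metis real_membersE)
  have "\<bar>g i\<bar> \<le> norm x + 1" for i
    using norm_bounded[of x i] by (simp add: x(2))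
  then show ?thesis
    by (intro that[of "norm x + 1"]) (auto intro: add_nonneg_pos)
qed

lemma real_members_uniform_limit:
  assumes approx: "\<And>e. 0 < e \<Longrightarrow> \<exists>h\<in>real_members M. \<forall>i. \<bar>g i - h i\<bar> \<le> e"
  shows "g \<in> real_members M"
proof -
  obtain h B where h: "\<And>i. \<bar>g i - h i\<bar> \<le> 1" "\<And>i. \<bar>h i\<bar> \<le> B"
    using approx[of 1] real_members_bounded by (metis zero_less_one)
  have "norm (complex_of_real (g i)) \<le> B + 1" for i
    using h(1)[of i] h(2)[of i] by simp
  then have "(\<lambda>i. complex_of_real (g i)) \<in> bcontfun"
    by (intro bcontfun_normI) auto
  then obtain z :: linf where z: "\<And>i. z i = of_real (g i)"
    by (metis Bcontfun_inverse)
  have "z \<in> closure M"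
    unfolding closure_approachable
  proof (intro allI impI)
    fix e :: real assume "0 < e"
    then obtain h where h: "h \<in> real_members M" "\<And>i. \<bar>g i - h i\<bar> \<le> e / 2"
      using approx[of "e / 2"] by auto
    then obtain x where x: "x \<in> M" "\<And>i. x i = of_real (h i)"
      by (metis real_membersE)
    have "dist x z \<le> e / 2"
    proof (rule dist_bound)
      show "dist (x i) (z i) \<le> e / 2" for i
        using h(2)[of i]
        by (simp add: x(2) z dist_norm abs_minus_commute flip: of_real_diff)
    qed
    then show "\<exists>x\<in>M. dist x z < e"
      using x(1) \<open>0 < e\<close> by (intro bexI[of _ x]) auto
  qed
  then have "z \<in> M"
    using closed by simp
  then show ?thesis
    using z by (auto simp: real_members_def)
qed

text \<open>The quadratic term of the square root at \<open>1\<close>, extracted by rescaling.\<close>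

lemma real_members_square:
  assumes g: "g \<in> real_members M"
  shows "(\<lambda>i. (g i)\<^sup>2) \<in> real_members M"
proof (rule real_members_uniform_limit)
  fix e :: real assume "0 < e"
  obtain B where B: "0 < B" "\<And>i. \<bar>g i\<bar> \<le> B"
    using real_members_bounded[OF g] by blast
  \<comment> \<open>The first bound on \<open>t\<close> keeps \<open>1 + t g\<close> nonnegative, the second makes the error
    \<open>3 \<bar>t g\<bar>\<^sup>3 / t\<^sup>2\<close> at most \<open>e\<close>.\<close>
  define t where "t = min (1 / B) (e / (3 * B ^ 3))"
  have t: "0 < t" "t * B \<le> 1" "3 * t * B ^ 3 \<le> e"
  proof -
    show "0 < t"
      using B \<open>0 < e\<close> by (simp add: t_def)
    have "t \<le> 1 / B" "t \<le> e / (3 * B ^ 3)"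
      by (auto simp: t_def)
    then show "t * B \<le> 1" "3 * t * B ^ 3 \<le> e"
      using B(1) by (simp_all add: field_simps)
  qed
  have tg: "\<bar>t * g i\<bar> \<le> t * B" for i
    using B(2)[of i] t(1) by (simp add: abs_mult)
  have ge: "- 1 \<le> t * g i" for i
    using tg[of i] t(2) by linarith
  define h where "h = (\<lambda>i. 8 / t\<^sup>2 * (1 + (1 / 2) * (t * g i) - sqrt (1 + t * g i)))"
  have "h \<in> real_members M"
    unfolding h_def
  proof (intro real_members_scale real_members_diff real_members_add real_members_const
      real_members_sqrt g)
    show "0 \<le> 1 + t * g i" for i
      using ge[of i] by linarith
  qed
  moreover have "\<bar>(g i)\<^sup>2 - h i\<bar> \<le> e" for i
  proof -
    have "\<bar>(g i)\<^sup>2 - h i\<bar> =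
        \<bar>8 * (1 + t * g i / 2 - sqrt (1 + t * g i)) - (t * g i)\<^sup>2\<bar> / t\<^sup>2"
    proof -
      have "h i - (g i)\<^sup>2 = (8 * (1 + t * g i / 2 - sqrt (1 + t * g i)) - (t * g i)\<^sup>2) / t\<^sup>2"
        using t(1) by (simp add: h_def diff_divide_distrib power_mult_distrib)
      then show ?thesis
        by (simp add: abs_minus_commute[of "(g i)\<^sup>2"] abs_divide)
    qed
    also have "\<dots> \<le> 3 * \<bar>t * g i\<bar> ^ 3 / t\<^sup>2"
      by (intro divide_right_mono sqrt_second_order_error ge) simp
    also have "\<dots> \<le> 3 * (t * B) ^ 3 / t\<^sup>2"
      by (intro divide_right_mono mult_left_mono power_mono tg) auto
    also have "\<dots> = 3 * t * B ^ 3"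
      using t(1) by (simp add: power_mult_distrib power2_eq_square power3_eq_cube)
    also have "\<dots> \<le> e"
      by (rule t(3))
    finally show ?thesis .
  qed
  ultimately show "\<exists>h\<in>real_members M. \<forall>i. \<bar>(g i)\<^sup>2 - h i\<bar> \<le> e"
    by blast
qed

lemma real_members_mult:
  assumes "g \<in> real_members M" "h \<in> real_members M"
  shows "(\<lambda>i. g i * h i) \<in> real_members M"
proof -
  have "(\<lambda>i. (1 / 4) * ((g i + h i)\<^sup>2 - (g i - h i)\<^sup>2)) \<in> real_members M"
    using assms
    by (intro real_members_scale real_members_square real_members_diff[of "\<lambda>i. (g i + h i)\<^sup>2"]
        real_members_add real_members_diff[of g])
  then show ?thesis
    by (simp add: power2_eq_square algebra_simps)
qed

end

section \<open>Stone--Weierstrass for compact topologies on a countable set\<close>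

lemma continuous_on_coordinate: "continuous_on S (\<lambda>p :: 'a \<Rightarrow> 'b::topological_space. p x)"
  by (rule continuous_on_subset[OF continuous_on_product_coordinates subset_UNIV])

text \<open>One member of \<open>R\<close> for each of the countably many pairs of points embeds the space into a
  countable power of \<open>\<real>\<close>, a metric space to which the classical theorem, stated for the type class
  \<^class>\<open>t2_space\<close>, applies. The embedding is a homeomorphism onto its image because \<open>T\<close> is compact and
  the image is Hausdorff.\<close>

lemma Stone_Weierstrass_countable:
  fixes T :: "'a::countable topology" and R :: "('a \<Rightarrow> real) set"
  assumes compact: "compact_space T"
    and cont: "\<And>h. h \<in> R \<Longrightarrow> continuous_map T euclidean h"
    and const: "\<And>c. (\<lambda>_. c) \<in> R"
    and add: "\<And>g h. g \<in> R \<Longrightarrow> h \<in> R \<Longrightarrow> (\<lambda>a. g a + h a) \<in> R"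
    and mult: "\<And>g h. g \<in> R \<Longrightarrow> h \<in> R \<Longrightarrow> (\<lambda>a. g a * h a) \<in> R"
    and separate: "\<And>a b. \<lbrakk>a \<in> topspace T; b \<in> topspace T; a \<noteq> b\<rbrakk> \<Longrightarrow> \<exists>h\<in>R. h a \<noteq> h b"
    and f: "continuous_map T euclidean f" and "0 < e"
  shows "\<exists>h\<in>R. \<forall>a\<in>topspace T. \<bar>f a - h a\<bar> < e"
proof -
  have "\<forall>a b. \<exists>h\<in>R. a \<in> topspace T \<and> b \<in> topspace T \<and> a \<noteq> b \<longrightarrow> h a \<noteq> h b"
    using separate const by blast
  then obtain s where s: "\<And>a b. s a b \<in> R"
    "\<And>a b. \<lbrakk>a \<in> topspace T; b \<in> topspace T; a \<noteq> b\<rbrakk> \<Longrightarrow> s a b a \<noteq> s a b b"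
    by metis
  define F where "F = (\<lambda>c (a, b). s a b c)"
  define K where "K = F ` topspace T"
  have F: "F c (a, b) = s a b c" for a b c
    by (simp add: F_def)
  have "continuous_map T (product_topology (\<lambda>_. euclidean) UNIV) F"
    unfolding continuous_map_componentwise_UNIV by (auto simp: F cont s(1))
  then have contF: "continuous_map T euclidean F"
    by (simp add: euclidean_product_topology)
  have inj: "inj_on F (topspace T)"
    by (rule inj_onI) (metis F s(2))
  have "homeomorphic_map T (top_of_set K) F"
    using compact contF inj
    by (intro continuous_imp_homeomorphic_map)
      (auto simp: K_def continuous_map_in_subtopology Hausdorff_space_subtopology)
  then obtain G where G: "homeomorphic_maps T (top_of_set K) F G"
    using homeomorphic_map_maps by blast
  then have contG: "continuous_map (top_of_set K) T G"
    and GF: "\<And>a. a \<in> topspace T \<Longrightarrow> G (F a) = a"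
    by (auto simp: homeomorphic_maps_def)
  let ?P = "\<lambda>q. continuous_on K q \<and> (\<exists>h\<in>R. \<forall>a\<in>topspace T. q (F a) = h a)"
  have "\<exists>q. ?P q \<and> (\<forall>p\<in>K. \<bar>(f \<circ> G) p - q p\<bar> < e)"
  proof (rule Stone_Weierstrass_HOL)
    show "compact K"
      using image_compactin[OF _ contF, of "topspace T"] compact
      by (simp add: K_def compact_space_def)
    show "continuous_on K (f \<circ> G)"
      using continuous_map_compose[OF contG f] by simp
    show "?P (\<lambda>_. c)" for c
      using const by auto
    show "?P (\<lambda>p. q p + r p)" if qr: "?P q \<and> ?P r" for q r
    proof -
      obtain g h where "g \<in> R" "h \<in> R" "\<forall>a\<in>topspace T. q (F a) = g a"
        "\<forall>a\<in>topspace T. r (F a) = h a"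
        using qr by blast
      then show ?thesis
        using qr by (auto intro: continuous_on_add bexI[OF _ add[of g h]])
    qed
    show "?P (\<lambda>p. q p * r p)" if qr: "?P q \<and> ?P r" for q r
    proof -
      obtain g h where "g \<in> R" "h \<in> R" "\<forall>a\<in>topspace T. q (F a) = g a"
        "\<forall>a\<in>topspace T. r (F a) = h a"
        using qr by blast
      then show ?thesis
        using qr by (auto intro: continuous_on_mult bexI[OF _ mult[of g h]])
    qed
    show "\<exists>q. ?P q \<and> q p \<noteq> q p'" if p: "p \<in> K \<and> p' \<in> K \<and> p \<noteq> p'" for p p'
    proof -
      obtain a b where ab: "p = F a" "p' = F b" "a \<in> topspace T" "b \<in> topspace T" "a \<noteq> b"
        using p by (auto simp: K_def)
      have "?P (\<lambda>p. p (a, b))"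
        using s(1) by (auto simp: F intro: continuous_on_coordinate)
      moreover have "p (a, b) \<noteq> p' (a, b)"
        using ab s(2) by (simp add: F)
      ultimately show ?thesis
        by (intro exI[of _ "\<lambda>p. p (a, b)"]) simp
    qed
  qed (use \<open>0 < e\<close> in auto)
  then obtain q h where qh: "h \<in> R" "\<And>a. a \<in> topspace T \<Longrightarrow> q (F a) = h a"
    "\<And>p. p \<in> K \<Longrightarrow> \<bar>(f \<circ> G) p - q p\<bar> < e"
    by blast
  have "\<bar>f a - h a\<bar> < e" if "a \<in> topspace T" for a
    using qh(3)[of "F a"] qh(2)[OF that] GF[OF that] that by (simp add: K_def)
  then show ?thesis
    using qh(1) by blast
qed

section \<open>Compactness of the set of evaluations\<close>

lemma Hausdorff_space_euclidean_fun:
  "Hausdorff_space (euclidean :: ('a \<Rightarrow> 'b::metric_space) topology)"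
  using Hausdorff_space_product_topology[of "\<lambda>_::'a. euclidean :: 'b topology" UNIV]
  by (simp add: euclidean_product_topology)

text \<open>Setting the value to \<open>0\<close> outside \<open>M\<close> places the evaluations in the type
  \<^typ>\<open>linf \<Rightarrow> complex\<close>, whose topology is that of pointwise convergence.\<close>

definition evaluation :: "linf set \<Rightarrow> nat \<Rightarrow> (linf \<Rightarrow> complex)" where
  "evaluation M i = (\<lambda>x. if x \<in> M then x i else 0)"

locale sqrt_closed_predual = sqrt_closed_space +
  assumes surj: "canonical_map M ` l1 = dual_space M"
    and dense: "linf_pos \<subseteq> weak_star_topology closure_of (M \<inter> linf_pos)"
begin

lemma linf_posE:
  assumes "x \<in> M \<inter> linf_pos"
  obtains g where "g \<in> real_members M" "\<And>i. x i = complex_of_real (g i)"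
proof (rule that)
  show "x i = complex_of_real (Re (x i))" for i
    using assms by (auto simp: linf_pos_def complex_nonneg_Reals_iff complex_eq_iff)
  then show "(\<lambda>i. Re (x i)) \<in> real_members M"
    using assms by (auto simp: real_members_def)
qed

lemma real_members_separate:
  assumes "i \<noteq> j"
  obtains g where "g \<in> real_members M" "g i \<noteq> g j"
proof -
  obtain x where x: "x \<in> M \<inter> linf_pos" "x i \<noteq> x j"
    using weak_star_dense_separates[OF dense assms] by blast
  obtain g where g: "g \<in> real_members M" "\<And>i. x i = complex_of_real (g i)"
    using linf_posE[OF x(1)] by blast
  show ?thesis
    using that g x(2) by auto
qed

lemma inj_evaluation: "inj (evaluation M)"
proof (rule injI, rule ccontr)
  fix i j assume eq: "evaluation M i = evaluation M j" and "i \<noteq> j"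
  obtain x where x: "x \<in> M \<inter> linf_pos" "x i \<noteq> x j"
    using weak_star_dense_separates[OF dense \<open>i \<noteq> j\<close>] by blast
  have "evaluation M i x = evaluation M j x"
    using eq by simp
  with x show False
    by (simp add: evaluation_def)
qed

text \<open>The identities and bounds that hold at every evaluation define closed sets in the topology
  of pointwise convergence and so pass to the limit.\<close>

lemma closure_range_evaluation:
  assumes p: "p \<in> closure (range (evaluation M))"
  shows "x \<notin> M \<Longrightarrow> p x = 0"
    and "x \<in> M \<Longrightarrow> y \<in> M \<Longrightarrow> p (x + y) = p x + p y"
    and "x \<in> M \<Longrightarrow> p (cscale c x) = c * p x"
    and "norm (p x) \<le> norm x"
    and "p (const_bcontfun 1) = 1"
    and "\<lbrakk>x \<in> M; y \<in> M; z \<in> M; \<And>i. z i = x i * y i\<rbrakk> \<Longrightarrow> p z = p x * p y"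
proof -
  have limit: "P p" if "closed {q. P q}" "\<And>i. P (evaluation M i)" for P
    using closure_minimal[of "range (evaluation M)" "{q. P q}"] that p by blast
  note cont = continuous_on_coordinate continuous_intros
  show "p x = 0" if "x \<notin> M"
    by (rule limit[where P = "\<lambda>p. p x = 0"])
      (intro closed_Collect_eq cont, simp add: evaluation_def that)
  show "p (x + y) = p x + p y" if "x \<in> M" "y \<in> M"
    by (rule limit[where P = "\<lambda>p. p (x + y) = p x + p y"])
      (intro closed_Collect_eq cont, simp add: evaluation_def that add_mem)
  show "p (cscale c x) = c * p x" if "x \<in> M"
    by (rule limit[where P = "\<lambda>p. p (cscale c x) = c * p x"])
      (intro closed_Collect_eq cont, simp add: evaluation_def that cscale_mem)
  show "norm (p x) \<le> norm x"
    by (rule limit[where P = "\<lambda>p. norm (p x) \<le> norm x"])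
      (intro closed_Collect_le cont, simp add: evaluation_def norm_bounded)
  show "p (const_bcontfun 1) = 1"
    by (rule limit[where P = "\<lambda>p. p (const_bcontfun 1) = 1"])
      (intro closed_Collect_eq cont, simp add: evaluation_def unit const_bcontfun.rep_eq)
  show "p z = p x * p y" if "x \<in> M" "y \<in> M" "z \<in> M" "\<And>i. z i = x i * y i"
    by (rule limit[where P = "\<lambda>p. p z = p x * p y"])
      (intro closed_Collect_eq cont, simp add: evaluation_def that)
qed

lemma closure_range_evaluation_pairing:
  assumes p: "p \<in> closure (range (evaluation M))"
  obtains y where "y \<in> l1" "\<And>x. x \<in> M \<Longrightarrow> p x = pairing x y"
proof -
  note limit = closure_range_evaluation[OF p]
  have "restrict p M \<in> dual_space M"
    unfolding dual_space_def
    using limit(2-3) limit(4) by (auto simp: add_mem cscale_mem intro!: exI[of _ 1])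
  then obtain y where y: "y \<in> l1" "restrict p M = canonical_map M y"
    using surj by blast
  have "p x = pairing x y" if "x \<in> M" for x
    using fun_cong[OF y(2), of x] that by (simp add: canonical_map_def)
  with y(1) show ?thesis
    by (rule that)
qed

text \<open>If \<open>p\<close> is pairing with \<open>y\<close>, multiplicativity of \<open>p\<close> says that \<open>(g - p(g)) y\<close>
  annihilates \<open>M\<^sub>+\<close>, so that it vanishes and \<open>g = p(g)\<close> wherever \<open>y \<noteq> 0\<close>.\<close>

lemma closure_range_evaluation_constant_on_support:
  assumes p: "p \<in> closure (range (evaluation M))"
    and y: "y \<in> l1" "\<And>x. x \<in> M \<Longrightarrow> p x = pairing x y"
    and x: "x \<in> M" "\<And>i. x i = complex_of_real (g i)"
    and "y i \<noteq> 0"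
  shows "x i = p x"
proof -
  define d where "d = x - const_bcontfun (p x)"
  have d: "d k = x k - p x" for k
    by (simp add: d_def const_bcontfun.rep_eq)
  have "d i * y i = 0"
  proof (rule weak_star_dense_annihilator[OF dense mult_linf_in_l1[OF y(1), of d]])
    fix h assume h: "h \<in> M \<inter> linf_pos"
    obtain f where f: "f \<in> real_members M" "\<And>i. h i = complex_of_real (f i)"
      using linf_posE[OF h] by blast
    have "g \<in> real_members M"
      using x by (auto simp: real_members_def)
    then obtain z where z: "z \<in> M" "\<And>i. z i = complex_of_real (f i * g i)"
      using real_members_mult[OF f(1)] real_membersE by metis
    have "p z = p h * p x"
      using h x f(2) z by (intro closure_range_evaluation(6)[OF p]) auto
    then have "pairing z y = p x * pairing h y"
      using y(2) z(1) h by (simp add: mult.commute)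
    moreover have "pairing h (\<lambda>i. d i * y i) = pairing z y - p x * pairing h y"
    proof -
      have "pairing h (\<lambda>i. d i * y i) = (\<Sum>i. z i * y i - p x * (h i * y i))"
        unfolding pairing_def
        by (rule suminf_cong) (simp add: d z(2) f(2) x(2) algebra_simps)
      also have "\<dots> = pairing z y - p x * pairing h y"
        using summable_pairing[OF y(1)]
        by (simp add: pairing_def suminf_diff[symmetric] suminf_mult summable_mult)
      finally show ?thesis .
    qed
    ultimately show "pairing h (\<lambda>i. d i * y i) = 0"
      by simp
  qed
  with \<open>y i \<noteq> 0\<close> show ?thesis
    by (simp add: d)
qed

lemma closed_range_evaluation: "closed (range (evaluation M))"
proof -
  have "p \<in> range (evaluation M)" if p: "p \<in> closure (range (evaluation M))" for p
  proof -
    obtain y where y: "y \<in> l1" "\<And>x. x \<in> M \<Longrightarrow> p x = pairing x y"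
      using closure_range_evaluation_pairing[OF p] by blast
    have one: "(\<Sum>i. y i) = 1"
      using y(2)[OF unit] closure_range_evaluation(5)[OF p]
      by (simp add: pairing_def const_bcontfun.rep_eq)
    have "\<not> (\<forall>j. y j = 0)"
    proof
      assume "\<forall>j. y j = 0"
      then have "(\<Sum>i. y i) = 0" by simp
      with one show False by simp
    qed
    then obtain j where j: "y j \<noteq> 0"
      by blast
    have supp: "y i = 0" if "i \<noteq> j" for i
    proof (rule ccontr)
      assume "y i \<noteq> 0"
      obtain g where g: "g \<in> real_members M" "g i \<noteq> g j"
        using real_members_separate[OF \<open>i \<noteq> j\<close>] by blast
      obtain x where x: "x \<in> M" "\<And>i. x i = complex_of_real (g i)"
        using g(1) by (metis real_membersE)
      have "x i = p x" "x j = p x"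
        using closure_range_evaluation_constant_on_support[OF p y x] \<open>y i \<noteq> 0\<close> j by blast+
      with g(2) x(2) show False
        by (metis of_real_eq_iff)
    qed
    have sum: "(\<Sum>i. c i * y i) = c j * y j" for c :: "nat \<Rightarrow> complex"
      using suminf_finite[of "{j}" "\<lambda>i. c i * y i"] supp by simp
    have "y j = 1"
      using sum[of "\<lambda>_. 1"] one by simp
    then have "p x = x j" if "x \<in> M" for x
      using y(2)[OF that] sum[of x] by (simp add: pairing_def)
    then have "p = evaluation M j"
      using closure_range_evaluation(1)[OF p] by (auto simp: evaluation_def)
    then show ?thesis
      by simp
  qed
  then have "closure (range (evaluation M)) \<subseteq> range (evaluation M)"
    by blast
  then show ?thesis
    by (simp add: closure_subset_eq)
qed

lemma compact_range_evaluation: "compact (range (evaluation M))"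
proof -
  have "compactin (product_topology (\<lambda>_::linf. euclidean :: complex topology) UNIV)
      (Pi\<^sub>E UNIV (\<lambda>x. cball 0 (norm x)))"
    by (simp add: compactin_PiE)
  then have "compact (Pi\<^sub>E UNIV (\<lambda>x::linf. cball (0::complex) (norm x)))"
    by (simp add: euclidean_product_topology)
  moreover have "range (evaluation M) \<subseteq> Pi\<^sub>E UNIV (\<lambda>x. cball 0 (norm x))"
    by (auto simp: evaluation_def norm_bounded)
  ultimately show ?thesis
    using closed_range_evaluation compact_Int_closed inf.absorb2 by metis
qed

section \<open>The topology induced by the evaluations\<close>

definition evaluation_topology :: "nat topology" where
  "evaluation_topology = pullback_topology UNIV (evaluation M) euclidean"

lemma topspace_evaluation_topology: "topspace evaluation_topology = UNIV"
  by (simp add: evaluation_topology_def topspace_pullback_topology)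

lemma openin_evaluation_topology:
  "openin evaluation_topology U \<longleftrightarrow> (\<exists>V. open V \<and> U = evaluation M -` V)"
  by (simp add: evaluation_topology_def openin_pullback_topology)

lemma continuous_map_evaluation: "continuous_map evaluation_topology euclidean (evaluation M)"
  unfolding continuous_map_alt
  by (auto simp: topspace_evaluation_topology openin_evaluation_topology)

lemma Hausdorff_evaluation_topology: "Hausdorff_space evaluation_topology"
  using Hausdorff_space_injective_preimage[OF Hausdorff_space_euclidean_fun
      continuous_map_evaluation] inj_evaluation
  by (simp add: topspace_evaluation_topology)

text \<open>The inverse of the evaluation embedding is continuous because the topology on \<open>\<nat>\<close> is
  the one induced by it.\<close>

lemma continuous_map_inv_evaluation:
  "continuous_map (top_of_set (range (evaluation M))) evaluation_topology (inv (evaluation M))"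
  unfolding continuous_map_alt
proof (intro conjI strip)
  fix U assume "openin evaluation_topology U"
  then obtain V where V: "open V" "U = evaluation M -` V"
    by (auto simp: openin_evaluation_topology)
  have "inv (evaluation M) -` U \<inter> topspace (top_of_set (range (evaluation M)))
      = range (evaluation M) \<inter> V"
    using V(2) by (auto simp: f_inv_into_f)
  then show "openin (top_of_set (range (evaluation M)))
      (inv (evaluation M) -` U \<inter> topspace (top_of_set (range (evaluation M))))"
    using V(1) by (simp add: openin_open_Int)
qed (simp add: topspace_evaluation_topology)

lemma compact_evaluation_topology: "compact_space evaluation_topology"
proof -
  have "compactin (top_of_set (range (evaluation M))) (range (evaluation M))"
    using compact_range_evaluation by (simp add: compactin_subtopology)
  from image_compactin[OF this continuous_map_inv_evaluation]
  show ?thesis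
    by (simp add: compact_space_def topspace_evaluation_topology image_comp inj_evaluation)
qed

lemma continuous_map_member:
  assumes "x \<in> M"
  shows "continuous_map evaluation_topology euclidean (apply_bcontfun x)"
proof -
  have "continuous_map evaluation_topology euclidean ((\<lambda>p. p x) \<circ> evaluation M)"
    by (rule continuous_map_compose[OF continuous_map_evaluation])
      (simp add: continuous_on_coordinate)
  then show ?thesis
    using assms by (simp add: o_def evaluation_def)
qed

lemma continuous_real_in_real_members:
  assumes f: "continuous_map evaluation_topology euclidean (f :: nat \<Rightarrow> real)"
  shows "f \<in> real_members M"
proof (rule real_members_uniform_limit)
  fix e :: real assume "0 < e"
  have "\<exists>h\<in>real_members M. \<forall>i\<in>topspace evaluation_topology. \<bar>f i - h i\<bar> < e"
  proof (rule Stone_Weierstrass_countable[OF compact_evaluation_topology])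
    show "continuous_map evaluation_topology euclidean h" if "h \<in> real_members M" for h
    proof -
      obtain x where x: "x \<in> M" "\<And>i. x i = complex_of_real (h i)"
        using \<open>h \<in> real_members M\<close> by (metis real_membersE)
      have "continuous_map evaluation_topology euclidean (Re \<circ> apply_bcontfun x)"
        by (rule continuous_map_compose[OF continuous_map_member[OF x(1)]])
          (auto intro: continuous_intros)
      then show ?thesis
        by (simp add: o_def x(2))
    qed
    show "\<exists>h\<in>real_members M. h i \<noteq> h j" if "i \<noteq> j" for i j
      using real_members_separate[OF that] by blast
  qed (use \<open>0 < e\<close> f in \<open>auto intro: real_members_const real_members_add real_members_mult\<close>)
  then show "\<exists>h\<in>real_members M. \<forall>i. \<bar>f i - h i\<bar> \<le> e"
    by (auto simp: topspace_evaluation_topology intro: less_imp_le)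
qed

lemma C_tau_evaluation_topology: "C_tau evaluation_topology = M"
proof
  show "M \<subseteq> C_tau evaluation_topology"
    by (auto simp: C_tau_def continuous_map_member)
  show "C_tau evaluation_topology \<subseteq> M"
  proof
    fix x assume "x \<in> C_tau evaluation_topology"
    then have x: "continuous_map evaluation_topology euclidean (apply_bcontfun x)"
      by (simp add: C_tau_def)
    have part: "(\<lambda>i. r (x i)) \<in> real_members M" if "continuous_on UNIV r" for r
      using continuous_map_compose[OF x, of euclidean r] that
      by (intro continuous_real_in_real_members) (simp add: o_def)
    have "(\<lambda>i. Re (x i)) \<in> real_members M" "(\<lambda>i. Im (x i)) \<in> real_members M"
      by (intro part continuous_intros)+
    then obtain a b where a: "a \<in> M" "\<And>i. a i = complex_of_real (Re (x i))"
      and b: "b \<in> M" "\<And>i. b i = complex_of_real (Im (x i))"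
      by (metis (no_types, lifting) real_membersE)
    have "x = a + cscale \<i> b"
      by (rule bcontfun_eqI) (simp add: a(2) b(2) complex_eq)
    then show "x \<in> M"
      using a(1) b(1) by (simp add: add_mem cscale_mem)
  qed
qed

end

theorem theorem6:
  fixes M :: "linf set"
  assumes "l1_predual M"
    and "const_bcontfun 1 \<in> M"
    and "linf_pos \<subseteq> weak_star_topology closure_of (M \<inter> linf_pos)"
    and "\<And>x. x \<in> M \<inter> linf_pos \<Longrightarrow> linf_sqrt x \<in> M \<inter> linf_pos"
  shows "\<exists>T :: nat topology. topspace T = UNIV \<and> compact_space T \<and> Hausdorff_space T \<and> M = C_tau T"
proof -
  have M: "csubspace M" "closed M" "canonical_map M ` l1 = dual_space M"
    using assms(1) by (auto simp: l1_predual_def bij_betw_def)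
  interpret sqrt_closed_predual M
    by unfold_locales (fact M assms)+
  show ?thesis
    using topspace_evaluation_topology compact_evaluation_topology
      Hausdorff_evaluation_topology C_tau_evaluation_topology by blast
qed

end
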